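(* Let $\mu = \phi(x)\,dx$ be a probability measure on $[0,1]$ with smooth density $\phi$ satisfying $0 < c < \phi(x) < C < \infty$ for some constants $c,C$ and all $x\in[0,1]$, and let $\Phi(x)=\int_0^x\phi(y)\,dy$. Assume that the equation $x = \Phi(x)$ has only finitely many solutions in $[0,1]$. Then $$\min_{0 \leq x \leq 1} \frac{\partial E(\mu)}{\partial x} < 0,$$ and the global minimum of $x\mapsto \partial E(\mu)/\partial x$ over $[0,1]$ is attained in a fixed point of the cumulative distribution function, i.e. in a point satisfying $\Phi(x) = x$. Moreover: (1) for every interval $J \subset [0,1]$ such that either $\Phi(x) > x$ for all $x\in J$ or $\Phi(x) < x$ for all $x\in J$, $$\min_{0 \leq x \leq 1} \frac{\partial E(\mu)}{\partial x} \leq - \frac{|J|^2}{4};$$ (2) if the equation $\Phi(x) = x$ has only $S$ solutions in $[0,1]$, then $$\min_{0 \leq x \leq 1} \frac{\partial E(\mu)}{\partial x} \leq - \frac{1}{4S}.$$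
   Context: $|J|$ denotes the length of $J$. For a probability measure $\mu=\phi(x)\,dx$ on $[0,1]$ with smooth density bounded away from $0$ and from above, with cumulative distribution function $\Phi$, the energy is $$E(\mu) = \int_0^1 \left|\Phi^{-1}(t)-t\right|dt = \int_0^1 |t-\Phi(t)|\,\phi(t)\,dt.$$ For a general probability measure $\nu$ on $[0,1]$ with cumulative distribution function $F_\nu(y)=\nu([0,y])$, the energy is understood as $E(\nu)=\int_0^1 |F_\nu^{-1}(t)-t|\,dt$, where $F_\nu^{-1}(t)=\inf\{y\in[0,1]: F_\nu(y)\ge t\}$ is the quantile function. For $x\in[0,1]$, the change of energy under adding an infinitesimal amount of mass in $x$ is $$\frac{\partial E(\mu)}{\partial x} := \lim_{\varepsilon\to 0^+}\frac{1}{\varepsilon}\Big(E\big((1-\varepsilon)\mu+\varepsilon\delta_x\big)-E(\mu)\Big),$$ where $\delta_x$ is the Dirac measure in $x$. *)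

theory Defs
  imports "HOL-Probability.Probability"
begin

text \<open>C-infinity on \<open>S\<close>, with one-sided derivatives at boundary points of an interval \<open>S\<close>.\<close>

definition smooth_on :: "real set \<Rightarrow> (real \<Rightarrow> real) \<Rightarrow> bool" where
  "smooth_on S f \<longleftrightarrow>
     (\<exists>D :: nat \<Rightarrow> real \<Rightarrow> real. D 0 = f \<and>
        (\<forall>n. \<forall>x\<in>S. (D n has_real_derivative D (Suc n) x) (at x within S)))"

text \<open>Measures on the unit interval have \<open>{0..1}\<close> as their carrier and its Borel sets as
  their sigma-algebra.\<close>

definition density_measure :: "(real \<Rightarrow> real) \<Rightarrow> real measure" where
  "density_measure \<phi> = density (restrict_space lborel {0..1}) (\<lambda>x. ennreal (\<phi> x))"

definition unit_cdf :: "real measure \<Rightarrow> real \<Rightarrow> real" where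
  "unit_cdf \<nu> y = measure \<nu> {0..y}"

definition quantile :: "real measure \<Rightarrow> real \<Rightarrow> real" where
  "quantile \<nu> t = Inf {y \<in> {0..1}. unit_cdf \<nu> y \<ge> t}"

definition energy :: "real measure \<Rightarrow> real" where
  "energy \<nu> = (LBINT t:{0..1}. \<bar>quantile \<nu> t - t\<bar>)"

text \<open>\<open>(1 - \<epsilon>) M + \<epsilon> N\<close>, intended for \<open>0 \<le> \<epsilon> \<le> 1\<close> and \<open>sets M = sets N\<close>.\<close>

definition mix_measure :: "real \<Rightarrow> 'a measure \<Rightarrow> 'a measure \<Rightarrow> 'a measure" where
  "mix_measure \<epsilon> M N =
     measure_of (space M) (sets M) (\<lambda>A. ennreal (1 - \<epsilon>) * emeasure M A + ennreal \<epsilon> * emeasure N A)"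

lemma space_mix_measure [simp]: "space (mix_measure \<epsilon> M N) = space M"
  by (simp add: mix_measure_def)

lemma sets_mix_measure [simp]: "sets (mix_measure \<epsilon> M N) = sets M"
  by (simp add: mix_measure_def)

lemma emeasure_mix_measure:
  assumes sets: "sets N = sets M" and A: "A \<in> sets M"
  shows "emeasure (mix_measure \<epsilon> M N) A = ennreal (1 - \<epsilon>) * emeasure M A + ennreal \<epsilon> * emeasure N A"
proof (rule emeasure_measure_of[OF mix_measure_def])
  show "countably_additive (sets (mix_measure \<epsilon> M N))
          (\<lambda>A. ennreal (1 - \<epsilon>) * emeasure M A + ennreal \<epsilon> * emeasure N A)"
  proof (rule countably_additiveI)
    fix B :: "nat \<Rightarrow> 'a set"
    assume "range B \<subseteq> sets (mix_measure \<epsilon> M N)" "disjoint_family B"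
    then show "(\<Sum>i. ennreal (1 - \<epsilon>) * emeasure M (B i) + ennreal \<epsilon> * emeasure N (B i)) =
        ennreal (1 - \<epsilon>) * emeasure M (\<Union> (range B)) + ennreal \<epsilon> * emeasure N (\<Union> (range B))"
      by (simp add: sets suminf_add[symmetric] suminf_emeasure)
  qed
qed (use A in \<open>auto simp: positive_def sets.space_closed\<close>)

definition energy_quotient :: "real measure \<Rightarrow> real \<Rightarrow> real \<Rightarrow> real" where
  "energy_quotient \<mu> x \<epsilon> = (energy (mix_measure \<epsilon> \<mu> (return \<mu> x)) - energy \<mu>) / \<epsilon>"

text \<open>\<^const>\<open>Lim\<close> is only meaningful where the limit exists.\<close>

definition energy_deriv :: "real measure \<Rightarrow> real \<Rightarrow> real" where
  "energy_deriv \<mu> x = Lim (at_right 0) (energy_quotient \<mu> x)"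

end

theory Submission
  imports Defs
begin

text \<open>By Fubini, \<open>E(\<nu>) = \<integral> \<bar>F\<^sub>\<nu>(y) - y\<bar> dy\<close>, so dominated convergence gives
  \<open>\<partial>E(\<mu>)/\<partial>x = D(x) = \<integral> s(y) (1[x \<le> y] - \<Phi>(y)) dy\<close> with \<open>s(y) = sgn (\<Phi>(y) - y)\<close>.
  Between consecutive fixed points \<open>D\<close> is affine with slope \<open>-s = \<plusminus>1\<close>, so its minimum \<open>m\<close> is attained at a
  fixed point. Moreover \<open>\<integral> D dx = -E(\<mu>) \<le> 0\<close>, hence \<open>m \<le> - \<integral> (D - m) dx\<close>, and every interval of
  length \<open>l\<close> without fixed points contributes at least \<open>l\<^sup>2 / 2\<close> to the last integral.\<close>

section \<open>Threshold integrals and Fubini on the unit square\<close>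

text \<open>The distance of two points is the length of the set of thresholds \<open>y\<close> that
  separate them. Up-sets serve when the variable is a position, down-sets when it is a level of the
  distribution function.\<close>

lemma integral_abs_indicator_diff:
  fixes q t :: real
  assumes "q \<in> {0..1}" "t \<in> {0..1}"
  shows "(\<integral>y. indicator {0..1} y * \<bar>indicator {q..} y - indicator {t..} y\<bar> \<partial>lborel) = \<bar>q - t\<bar>"
    and "(\<integral>y. indicator {0..1} y * \<bar>indicator {..q} y - indicator {..t} y\<bar> \<partial>lborel) = \<bar>q - t\<bar>"
proof -
  have "(\<lambda>y. indicator {0..1} y * \<bar>indicator {q..} y - indicator {t..} y\<bar>)
      = (indicator {min q t..<max q t} :: real \<Rightarrow> real)"
    using assms by (auto simp: fun_eq_iff indicator_def)
  then show "(\<integral>y. indicator {0..1} y * \<bar>indicator {q..} y - indicator {t..} y\<bar> \<partial>lborel) = \<bar>q - t\<bar>"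
    by simp
  have "(\<lambda>y. indicator {0..1} y * \<bar>indicator {..q} y - indicator {..t} y\<bar>)
      = (indicator {min q t<..max q t} :: real \<Rightarrow> real)"
    using assms by (auto simp: fun_eq_iff indicator_def)
  then show "(\<integral>y. indicator {0..1} y * \<bar>indicator {..q} y - indicator {..t} y\<bar> \<partial>lborel) = \<bar>q - t\<bar>"
    by simp
qed

text \<open>Cut off to a set of measure 1, a bounded function is dominated by a multiple of an
  indicator; this is the integrability that Fubini asks for.\<close>

lemma integrable_unit_square:
  fixes f :: "real \<Rightarrow> real \<Rightarrow> real"
  assumes [measurable]: "case_prod f \<in> borel_measurable (borel \<Otimes>\<^sub>M borel)"
    and bound: "\<And>x y. x \<in> {0..1} \<Longrightarrow> y \<in> {0..1} \<Longrightarrow> \<bar>f x y\<bar> \<le> B"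
  shows "integrable (lborel \<Otimes>\<^sub>M lborel)
    (\<lambda>(x, y). indicator {0..1} x * (indicator {0..1} y * f x y))"
proof (rule Bochner_Integration.integrable_bound)
  have "emeasure (lborel \<Otimes>\<^sub>M lborel) ({0..1::real} \<times> {0..1::real}) = 1"
    by (subst lborel.emeasure_pair_measure_Times) auto
  then show "integrable (lborel \<Otimes>\<^sub>M lborel) (\<lambda>z. B * indicator ({0..1::real} \<times> {0..1::real}) z)"
    by (intro integrable_mult_right integrable_real_indicator) auto
  show "(\<lambda>(x, y). indicator {0..1} x * (indicator {0..1} y * f x y))
      \<in> borel_measurable (lborel \<Otimes>\<^sub>M lborel)"
    by measurable
  show "AE z in lborel \<Otimes>\<^sub>M lborel. norm (case z of (x, y) \<Rightarrow> indicator {0..1} x * (indicator {0..1} y * f x y))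
      \<le> norm (B * indicator ({0..1::real} \<times> {0..1::real}) z)"
    using bound by (intro AE_I2) (force simp: indicator_def)
qed

lemma Fubini_unit_square:
  fixes f :: "real \<Rightarrow> real \<Rightarrow> real"
  assumes "case_prod f \<in> borel_measurable (borel \<Otimes>\<^sub>M borel)"
    and "\<And>x y. x \<in> {0..1} \<Longrightarrow> y \<in> {0..1} \<Longrightarrow> \<bar>f x y\<bar> \<le> B"
  shows "(LBINT x:{0..1}. LBINT y:{0..1}. f x y) = (LBINT y:{0..1}. LBINT x:{0..1}. f x y)"
proof -
  have "(LBINT x. LBINT y. indicator {0..1} x * (indicator {0..1} y * f x y))
      = (LBINT y. LBINT x. indicator {0..1} x * (indicator {0..1} y * f x y))"
    using lborel_pair.Fubini_integral[OF integrable_unit_square[OF assms]] by simp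
  then show ?thesis
    by (simp add: set_lebesgue_integral_def mult.left_commute)
qed

section \<open>The energy as the area between the distribution function and the diagonal\<close>

locale unit_prob_space = prob_space \<nu> for \<nu> :: "real measure" +
  assumes sets_unit: "sets \<nu> = sets (restrict_space borel {0..1})"
begin

lemma space_unit: "space \<nu> = {0..1}"
  using sets_eq_imp_space_eq[OF sets_unit] by (simp add: space_restrict_space)

lemma borel_measurable_ident_unit: "(\<lambda>x. x) \<in> borel_measurable \<nu>"
  by (subst measurable_cong_sets[OF sets_unit refl]) (simp add: measurable_restrict_space1)

text \<open>The carrier of \<open>\<nu>\<close> is the unit interval; pushing \<open>\<nu>\<close>
  forward along the inclusion into the line gives access to monotonicity and right continuity of
  \<open>cdf\<close>.\<close>

sublocale N: real_distribution "distr \<nu> borel (\<lambda>x. x)"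
  by (rule real_distribution_distr) (rule borel_measurable_ident_unit)

lemma unit_cdf_eq_cdf:
  assumes "y \<in> {0..1}"
  shows "unit_cdf \<nu> y = cdf (distr \<nu> borel (\<lambda>x. x)) y"
  unfolding cdf_def unit_cdf_def using assms borel_measurable_ident_unit
  by (subst measure_distr) (auto simp: space_unit intro!: arg_cong[where f="measure \<nu>"])

lemma unit_cdf_1: "unit_cdf \<nu> 1 = 1"
  unfolding unit_cdf_def using prob_space space_unit by simp

lemma quantile_in_unit:
  assumes "t \<in> {0..1}"
  shows "quantile \<nu> t \<in> {0..1}"
proof -
  let ?A = "{z \<in> {0..1}. unit_cdf \<nu> z \<ge> t}"
  have "1 \<in> ?A" using assms unit_cdf_1 by auto
  then have "0 \<le> Inf ?A" "Inf ?A \<le> 1"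
    by (auto intro!: cInf_greatest cInf_lower bdd_belowI)
  then show ?thesis by (simp add: quantile_def)
qed

text \<open>This is the Galois connection between quantile and distribution function. By right
  continuity the level \<open>t\<close> is already reached at the infimum, and monotonicity carries
  it on to \<open>y\<close>.\<close>

lemma quantile_le_iff:
  assumes t: "t \<in> {0..1}" and y: "y \<in> {0..1}"
  shows "quantile \<nu> t \<le> y \<longleftrightarrow> t \<le> unit_cdf \<nu> y"
proof -
  let ?F = "cdf (distr \<nu> borel (\<lambda>x. x))"
  define A where "A = {z \<in> {0..1}. unit_cdf \<nu> z \<ge> t}"
  have A1: "1 \<in> A" using t unit_cdf_1 by (auto simp: A_def)
  have bdd: "bdd_below A" by (auto simp: A_def)
  have Q: "quantile \<nu> t = Inf A" by (simp add: quantile_def A_def)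
  have ge: "t \<le> ?F z" if "z > Inf A" for z
  proof -
    obtain a where a: "a \<in> A" "a < z" using cInf_lessD[of A z] A1 \<open>z > Inf A\<close> by blast
    then have "t \<le> ?F a" using unit_cdf_eq_cdf by (auto simp: A_def)
    also have "\<dots> \<le> ?F z" using a by (intro N.cdf_nondecreasing) simp
    finally show ?thesis .
  qed
  have "(?F \<longlongrightarrow> ?F (Inf A)) (at_right (Inf A))"
    using N.cdf_is_right_cont[of "Inf A"] by (simp add: continuous_within)
  then have att: "t \<le> ?F (Inf A)"
    by (rule tendsto_lowerbound) (auto simp: eventually_at_filter ge intro: always_eventually)
  show ?thesis
  proof
    assume "quantile \<nu> t \<le> y"
    then have "?F (Inf A) \<le> ?F y" using Q by (intro N.cdf_nondecreasing) simp
    then show "t \<le> unit_cdf \<nu> y" using att unit_cdf_eq_cdf[OF y] by simp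
  next
    assume "t \<le> unit_cdf \<nu> y"
    then have "y \<in> A" using y by (simp add: A_def)
    then show "quantile \<nu> t \<le> y" using Q cInf_lower[OF _ bdd] by simp
  qed
qed

text \<open>Both sides are the area between the graph of the distribution function and the diagonal,
  sliced along the two axes. The right-hand side is affine in \<open>\<nu>\<close> inside the
  absolute value, hence easy to differentiate.\<close>

lemma energy_eq_integral_cdf: "energy \<nu> = (LBINT y:{0..1}. \<bar>unit_cdf \<nu> y - y\<bar>)"
proof -
  define F where "F = cdf (distr \<nu> borel (\<lambda>x. x))"
  have [measurable]: "F \<in> borel_measurable borel"
    unfolding F_def by (rule borel_measurable_mono) (simp add: mono_def N.cdf_nondecreasing)
  have F: "F y \<in> {0..1}" for y
    by (simp add: F_def N.cdf_nonneg N.cdf_bounded_prob)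
  let ?f = "\<lambda>t y. \<bar>indicator {..F y} t - indicator {..y} t\<bar> :: real"
  have "energy \<nu> = (LBINT t:{0..1}. LBINT y:{0..1}. ?f t y)"
    unfolding energy_def
  proof (intro set_lebesgue_integral_cong, simp, safe)
    fix t :: real assume t: "t \<in> {0..1}"
    have "\<bar>quantile \<nu> t - t\<bar>
        = (LBINT y. indicator {0..1} y * \<bar>indicator {quantile \<nu> t..} y - indicator {t..} y\<bar>)"
      using integral_abs_indicator_diff(1)[OF quantile_in_unit[OF t] t] by simp
    \<comment> \<open>By the Galois connection, \<open>y\<close> lies above the quantile of
      \<open>t\<close> exactly when \<open>t\<close> lies below \<open>F y\<close>.\<close>
    also have "\<dots> = (LBINT y. indicator {0..1} y * ?f t y)"
      using quantile_le_iff[OF t] unit_cdf_eq_cdf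
      by (intro Bochner_Integration.integral_cong) (auto simp: F_def indicator_def)
    finally show "\<bar>quantile \<nu> t - t\<bar> = (LBINT y:{0..1}. ?f t y)"
      by (simp add: set_lebesgue_integral_def)
  qed
  also have "\<dots> = (LBINT y:{0..1}. LBINT t:{0..1}. ?f t y)"
  proof (rule Fubini_unit_square)
    \<comment> \<open>Joint measurability becomes visible once the indicators are those of fixed
      sets in the plane.\<close>
    have "case_prod ?f = (\<lambda>z. \<bar>indicator {z. fst z \<le> F (snd z)} z - indicator {z. fst z \<le> snd z} z\<bar>)"
      by (auto simp: fun_eq_iff indicator_def)
    then show "case_prod ?f \<in> borel_measurable (borel \<Otimes>\<^sub>M borel)"
      by simp
    show "\<bar>?f t y\<bar> \<le> 1" for t y
      by (simp add: indicator_def)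
  qed
  also have "\<dots> = (LBINT y:{0..1}. \<bar>unit_cdf \<nu> y - y\<bar>)"
  proof (intro set_lebesgue_integral_cong, simp, safe)
    fix y :: real assume y: "y \<in> {0..1}"
    show "(LBINT t:{0..1}. ?f t y) = \<bar>unit_cdf \<nu> y - y\<bar>"
      using integral_abs_indicator_diff(2)[OF F y] unit_cdf_eq_cdf[OF y]
      by (simp add: set_lebesgue_integral_def F_def)
  qed
  finally show ?thesis .
qed

end

section \<open>The one-sided derivative of the energy\<close>

lemma set_integrable_bounded:
  fixes f :: "real \<Rightarrow> real"
  assumes [measurable]: "f \<in> borel_measurable borel" and ab: "{a..b} \<subseteq> {0..1}"
    and bound: "\<And>x. x \<in> {0..1} \<Longrightarrow> \<bar>f x\<bar> \<le> B"
  shows "set_integrable lborel {a..b} f"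
  unfolding set_integrable_def
proof (rule Bochner_Integration.integrable_bound)
  show "integrable lborel (\<lambda>x. B * indicator {a..b} x)"
    by (intro integrable_mult_right integrable_real_indicator) (auto simp: emeasure_lborel_Icc_eq)
  show "AE x in lborel. norm (indicator {a..b} x *\<^sub>R f x) \<le> norm (B * indicator {a..b} x)"
    using bound ab by (intro AE_I2) (fastforce simp: indicator_def subset_eq)
qed simp

text \<open>For small \<open>\<epsilon>\<close> the perturbed value keeps the sign of
  \<open>h\<close>, so the quotient is eventually equal to its limit.\<close>

lemma abs_diff_quotient_tendsto:
  fixes h k :: real
  assumes "h \<noteq> 0"
  shows "((\<lambda>\<epsilon>. (\<bar>h + \<epsilon> * k\<bar> - \<bar>h\<bar>) / \<epsilon>) \<longlongrightarrow> sgn h * k) (at_right 0)"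
proof -
  \<comment> \<open>Positivity of the product with \<open>h\<close> expresses that the sign is kept,
    for both signs of \<open>h\<close> at once.\<close>
  have "((\<lambda>\<epsilon>. h * (h + \<epsilon> * k)) \<longlongrightarrow> h * (h + 0 * k)) (at_right 0)"
    by (intro tendsto_intros)
  then have "\<forall>\<^sub>F \<epsilon> in at_right 0. 0 < h * (h + \<epsilon> * k)"
    by (rule order_tendstoD) (use assms in \<open>auto simp: zero_less_mult_iff\<close>)
  moreover have "\<forall>\<^sub>F \<epsilon> in at_right (0::real). 0 < \<epsilon>"
    by (simp add: eventually_at_right_less)
  ultimately have "\<forall>\<^sub>F \<epsilon> in at_right 0. (\<bar>h + \<epsilon> * k\<bar> - \<bar>h\<bar>) / \<epsilon> = sgn h * k"
    by eventually_elim (auto simp: zero_less_mult_iff)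
  then show ?thesis by (rule tendsto_eventually)
qed

text \<open>Collects what the study of the derivative uses about the distribution function.
  Continuity on \<open>UNIV\<close> makes \<open>F\<close> measurable on the line; the final proof
  obtains it by a constant extension beyond the unit interval.\<close>

locale fixed_point_gaps =
  fixes F :: "real \<Rightarrow> real"
  assumes cont: "continuous_on UNIV F"
    and F_0: "F 0 = 0" and F_1: "F 1 = 1"
    and F_unit: "\<And>x. x \<in> {0..1} \<Longrightarrow> F x \<in> {0..1}"
    and fin: "finite {x \<in> {0..1}. F x = x}"
begin

definition s :: "real \<Rightarrow> real" where
  "s y = sgn (F y - y)"

text \<open>The factor \<open>indicator {x..} y - F y\<close> is the derivative in
  \<open>\<epsilon>\<close> of the mixed distribution function, since \<open>indicator {x..}\<close>
  belongs to the Dirac measure in \<open>x\<close>; \<open>s y\<close> is the derivative of the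
  absolute value.\<close>

definition D :: "real \<Rightarrow> real" where
  "D x = (LBINT y:{0..1}. s y * (indicator {x..} y - F y))"

lemma F_measurable [measurable]: "F \<in> borel_measurable borel"
  using cont by (rule borel_measurable_continuous_onI)

lemma s_measurable [measurable]: "s \<in> borel_measurable borel"
  unfolding s_def by measurable

lemma abs_s_le: "\<bar>s y\<bar> \<le> 1"
  by (simp add: s_def sgn_if)

lemma abs_indicator_diff_F_le:
  assumes "y \<in> {0..1}"
  shows "\<bar>indicator A y - F y\<bar> \<le> 1"
  using F_unit[OF assms] by (auto simp: indicator_def)

lemma abs_integrand_le:
  assumes "y \<in> {0..1}"
  shows "\<bar>s y * (indicator A y - F y)\<bar> \<le> 1"
  using mult_mono[OF abs_s_le abs_indicator_diff_F_le[OF assms]] by (simp add: abs_mult)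

text \<open>At fixed points the absolute value sits at its kink; being finitely many, they form a
  null set.\<close>

lemma AE_not_fixed: "AE y in lborel. y \<in> {0..1} \<longrightarrow> F y \<noteq> y"
proof -
  have "AE y in lborel. y \<notin> {x \<in> {0..1}. F x = x}"
    using finite_imp_null_set_lborel[OF fin] by (rule AE_not_in)
  then show ?thesis by eventually_elim auto
qed

text \<open>Dominated convergence along sequences \<open>S\<close> decreasing to 0 from the right in
  the sense of \<open>at_right\<close>: the integrands converge off the fixed points and are bounded
  by 1.\<close>

lemma quotient_tendsto_D:
  "((\<lambda>\<epsilon>. ((LBINT y:{0..1}. \<bar>(1 - \<epsilon>) * F y + \<epsilon> * indicator {x..} y - y\<bar>)
        - (LBINT y:{0..1}. \<bar>F y - y\<bar>)) / \<epsilon>) \<longlongrightarrow> D x) (at_right 0)"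
proof (rule tendsto_at_right_sequentially)
  show "(0::real) < 1" by simp
  fix S :: "nat \<Rightarrow> real"
  assume S: "\<And>n. 0 < S n" "\<And>n. S n < 1" "S \<longlonglongrightarrow> 0"
  let ?h = "\<lambda>y. F y - y" and ?k = "\<lambda>y. indicator {x..} y - F y"
  let ?q = "\<lambda>n y. (\<bar>?h y + S n * ?k y\<bar> - \<bar>?h y\<bar>) / S n"
  \<comment> \<open>Used for \<open>e = S n\<close> and for \<open>e = 0\<close>, the perturbed and
    the unperturbed integrand.\<close>
  have int: "set_integrable lborel {0..1} (\<lambda>y. \<bar>?h y + e * ?k y\<bar>)" if "e \<in> {0..1}" for e
  proof (rule set_integrable_bounded)
    fix y :: real assume y: "y \<in> {0..1}"
    have "\<bar>e * ?k y\<bar> \<le> 1"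
      using mult_mono[of "\<bar>e\<bar>" 1 "\<bar>?k y\<bar>" 1] that abs_indicator_diff_F_le[OF y]
      by (simp add: abs_mult)
    then show "\<bar>\<bar>?h y + e * ?k y\<bar>\<bar> \<le> 2"
      using y F_unit[OF y] by auto
  qed auto
  have "(LBINT y:{0..1}. \<bar>(1 - S n) * F y + S n * indicator {x..} y - y\<bar>)
        - (LBINT y:{0..1}. \<bar>F y - y\<bar>) = S n * (LBINT y:{0..1}. ?q n y)" for n
  proof -
    have "(LBINT y:{0..1}. \<bar>?h y + S n * ?k y\<bar>) - (LBINT y:{0..1}. \<bar>?h y\<bar>)
        = (LBINT y:{0..1}. \<bar>?h y + S n * ?k y\<bar> - \<bar>?h y\<bar>)"
      using int[of "S n"] int[of 0] S(1,2)[of n] by (subst set_integral_diff) auto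
    also have "\<dots> = (LBINT y:{0..1}. S n * ?q n y)"
      using S(1)[of n] by simp
    also have "\<dots> = S n * (LBINT y:{0..1}. ?q n y)"
      by (rule set_integral_mult_right)
    finally have "(LBINT y:{0..1}. \<bar>?h y + S n * ?k y\<bar>) - (LBINT y:{0..1}. \<bar>?h y\<bar>)
        = S n * (LBINT y:{0..1}. ?q n y)" .
    moreover have h: "?h y + S n * ?k y = (1 - S n) * F y + S n * indicator {x..} y - y" for y
      by (simp add: algebra_simps)
    ultimately show ?thesis by (simp only: h)
  qed
  then have eq: "((LBINT y:{0..1}. \<bar>(1 - S n) * F y + S n * indicator {x..} y - y\<bar>)
        - (LBINT y:{0..1}. \<bar>F y - y\<bar>)) / S n = (LBINT y:{0..1}. ?q n y)" for n
    using S(1)[of n] by simp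
  have "(\<lambda>n. LBINT y:{0..1}. ?q n y) \<longlonglongrightarrow> D x"
    unfolding D_def set_lebesgue_integral_def
  proof (rule integral_dominated_convergence)
    show "integrable lborel (indicator {0..1} :: real \<Rightarrow> real)" by simp
    have "filterlim S (at_right 0) sequentially"
      using S(1,3) by (simp add: filterlim_at less_imp_neq[symmetric])
    then have q: "(\<lambda>n. ?q n y) \<longlonglongrightarrow> s y * ?k y" if "F y \<noteq> y" for y
      unfolding s_def using that
      by (intro filterlim_compose[OF abs_diff_quotient_tendsto]) auto
    show "AE y in lborel. (\<lambda>n. indicator {0..1} y *\<^sub>R ?q n y)
        \<longlonglongrightarrow> indicator {0..1} y *\<^sub>R (s y * ?k y)"
      using AE_not_fixed
    proof eventually_elim
      case (elim y)
      then show ?case using q[of y] by (cases "y \<in> {0..1}") simp_all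
    qed
    show "AE y in lborel. norm (indicator {0..1} y *\<^sub>R ?q n y) \<le> indicator {0..1} y" for n
    proof (rule AE_I2)
      fix y :: real
      have "\<bar>?q n y\<bar> \<le> 1" if y: "y \<in> {0..1}"
      proof -
        \<comment> \<open>The reverse triangle inequality removes \<open>?h\<close>, so the bound is
          uniform in \<open>n\<close>, also at fixed points.\<close>
        have "\<bar>\<bar>?h y + S n * ?k y\<bar> - \<bar>?h y\<bar>\<bar> \<le> \<bar>S n * ?k y\<bar>" by simp
        also have "\<dots> \<le> S n"
          using abs_indicator_diff_F_le[OF y, of "{x..}"] S(1)[of n] by (simp add: abs_mult)
        finally show ?thesis using S(1)[of n] by simp
      qed
      then show "norm (indicator {0..1} y *\<^sub>R ?q n y) \<le> indicator {0..1} y"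
        by (auto simp: indicator_def)
    qed
  qed measurable
  then show "(\<lambda>n. ((LBINT y:{0..1}. \<bar>(1 - S n) * F y + S n * indicator {x..} y - y\<bar>)
        - (LBINT y:{0..1}. \<bar>F y - y\<bar>)) / S n) \<longlonglongrightarrow> D x"
    by (simp only: eq)
qed

section \<open>Slopes and continuity of \<open>D\<close>\<close>

text \<open>The term with \<open>F\<close> does not depend on the base point and cancels; the two
  step functions differ exactly on \<open>{a..<b}\<close>.\<close>

lemma D_diff:
  assumes "0 \<le> a" "a \<le> b" "b \<le> 1"
  shows "D a - D b = (LBINT y:{a..<b}. s y)"
proof -
  have "set_integrable lborel {0..1} (\<lambda>y. s y * (indicator {x..} y - F y))" for x
    using abs_integrand_le by (intro set_integrable_bounded) auto
  then have "D a - D b = (LBINT y:{0..1}. s y * (indicator {a..} y - F y) - s y * (indicator {b..} y - F y))"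
    unfolding D_def by (subst set_integral_diff) auto
  also have "\<dots> = (LBINT y:{a..<b}. s y)"
    unfolding set_lebesgue_integral_def using assms
    by (intro Bochner_Integration.integral_cong) (auto simp: indicator_def algebra_simps)
  finally show ?thesis .
qed

lemma D_diff_eq_on_gap:
  assumes "0 \<le> a" "a \<le> x" "x \<le> z" "z \<le> b" "b \<le> 1" and \<sigma>: "\<And>y. y \<in> {a<..<b} \<Longrightarrow> s y = \<sigma>"
  shows "D x - D z = \<sigma> * (z - x)"
proof -
  have "D x - D z = (LBINT y:{x..<z}. s y)"
    using assms by (intro D_diff) auto
  also have "\<dots> = (LBINT y:{x..<z}. \<sigma>)"
    unfolding set_lebesgue_integral_def
  proof (rule integral_cong_AE)
    \<comment> \<open>The sign is known only inside the open gap. When \<open>x = a\<close>, the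
      left endpoint belongs to the domain of integration and is discarded as a null set.\<close>
    have "AE y in lborel. y \<noteq> a" by (rule AE_lborel_singleton)
    then show "AE y in lborel. indicator {x..<z} y *\<^sub>R s y = indicator {x..<z} y *\<^sub>R \<sigma>"
      by eventually_elim (use assms in \<open>auto simp: indicator_def\<close>)
  qed auto
  also have "\<dots> = \<sigma> * (z - x)"
    using assms by (simp add: set_integral_const)
  finally show ?thesis .
qed

text \<open>Since \<open>s\<close> is bounded by 1, \<open>D\<close> is 1-Lipschitz. The continuity
  that follows makes \<open>D\<close> attain its minimum.\<close>

lemma abs_D_diff_le:
  assumes "x \<in> {0..1}" "z \<in> {0..1}"
  shows "\<bar>D x - D z\<bar> \<le> \<bar>x - z\<bar>"
  using assms
proof (induction x z rule: linorder_wlog)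
  case (le x z)
  have "\<bar>LBINT y:{x..<z}. s y\<bar> \<le> (LBINT y:{x..<z}. 1)"
    unfolding set_lebesgue_integral_def
  proof (rule integral_abs_bound[THEN order_trans], rule integral_mono_AE')
    show "integrable lborel (\<lambda>y. indicator {x..<z} y *\<^sub>R (1::real))"
      using \<open>x \<le> z\<close> by simp
    show "AE y in lborel. \<bar>indicator {x..<z} y *\<^sub>R s y\<bar> \<le> indicator {x..<z} y *\<^sub>R (1::real)"
      using abs_s_le by (auto simp: indicator_def)
  qed (auto simp: indicator_def)
  then show ?case
    using le D_diff[of x z] by (simp add: set_integral_const)
next
  case (sym x z)
  then show ?case by (simp add: abs_minus_commute)
qed

lemma continuous_on_D: "continuous_on {0..1} D"
  by (rule lipschitz_on_continuous_on[of 1])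
    (auto intro!: lipschitz_onI simp: dist_real_def abs_D_diff_le)

section \<open>The mean of \<open>D\<close> and the contribution of each gap\<close>

text \<open>Averaging the Dirac measures over uniform \<open>x\<close> gives the uniform measure:
  integrating \<open>indicator {x..} y - F y\<close> over \<open>x\<close> yields
  \<open>y - F y\<close>, and multiplication by \<open>s y\<close> turns this into
  \<open>- \<bar>F y - y\<bar>\<close>.\<close>

lemma integral_D_nonpos: "(LBINT x:{0..1}. D x) \<le> 0"
proof -
  have "(LBINT x:{0..1}. D x)
      = (LBINT x:{0..1}. LBINT y:{0..1}. s y * (indicator {x..} y - F y))"
    by (simp add: D_def)
  also have "\<dots> = (LBINT y:{0..1}. LBINT x:{0..1}. s y * (indicator {x..} y - F y))"
  proof (rule Fubini_unit_square)
    have "(\<lambda>(x, y). s y * (indicator {x..} y - F y))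
        = (\<lambda>z. s (snd z) * (indicator {z. fst z \<le> snd z} z - F (snd z)))"
      by (auto simp: fun_eq_iff indicator_def)
    then show "(\<lambda>(x, y). s y * (indicator {x..} y - F y)) \<in> borel_measurable (borel \<Otimes>\<^sub>M borel)"
      by simp
  qed (rule abs_integrand_le)
  also have "\<dots> = (LBINT y:{0..1}. - \<bar>F y - y\<bar>)"
  proof (intro set_lebesgue_integral_cong, simp, safe)
    fix y :: real assume y: "y \<in> {0..1}"
    have "(LBINT x:{0..1}. indicator {x..} y - F y) = (LBINT x:{0..1}. indicator {0..y} x - F y)"
      by (intro set_lebesgue_integral_cong) (auto simp: indicator_def)
    also have "\<dots> = (LBINT x:{0..1}. indicator {0..y} x) - (LBINT x:{0..1::real}. F y)"
      by (intro set_integral_diff(2) set_integrable_bounded[of _ _ _ 1] set_integrable_bounded[of _ _ _ "\<bar>F y\<bar>"])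
        (auto simp: indicator_def)
    also have "(LBINT x:{0..1}. indicator {0..y} x) = (LBINT x. indicator {0..y} x :: real)"
      unfolding set_lebesgue_integral_def using y
      by (intro Bochner_Integration.integral_cong) (auto simp: indicator_def)
    finally have "(LBINT x:{0..1}. indicator {x..} y - F y) = y - F y"
      using y by (simp add: set_integral_const)
    then show "(LBINT x:{0..1}. s y * (indicator {x..} y - F y)) = - \<bar>F y - y\<bar>"
      by (simp add: s_def sgn_if)
  qed
  also have "\<dots> \<le> 0"
    by (simp add: set_lebesgue_integral_def)
  finally show ?thesis .
qed

lemma set_integrable_D:
  assumes "{a..b} \<subseteq> {0..1}"
  shows "set_integrable lborel {a..b} (\<lambda>x. D x - m)"
  using continuous_on_subset[OF continuous_on_D assms]
  by (intro borel_integrable_atLeastAtMost' continuous_intros)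

text \<open>On the gap \<open>D\<close> is affine with slope -1 or 1 and at least \<open>m\<close>
  at its lower end, so the graph of \<open>D - m\<close> lies above a right triangle with both legs
  \<open>b - a\<close>.\<close>

lemma gap_integral_ge:
  assumes ab: "0 \<le> a" "a \<le> b" "b \<le> 1"
    and gap: "(\<forall>x\<in>{a<..<b}. F x > x) \<or> (\<forall>x\<in>{a<..<b}. F x < x)"
    and min: "\<And>x. x \<in> {0..1} \<Longrightarrow> m \<le> D x"
  shows "(b - a)\<^sup>2 / 2 \<le> (LBINT x:{a..b}. D x - m)"
proof -
  \<comment> \<open>\<open>g\<close> is the hypotenuse, vanishing at the end where \<open>D\<close>
    is lowest: at \<open>b\<close> if \<open>F\<close> is above the diagonal, else at
    \<open>a\<close>. \<open>G\<close> is an antiderivative of it.\<close>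
  define g where "g = (if \<forall>x\<in>{a<..<b}. F x > x then (\<lambda>x. b - x) else (\<lambda>x. x - a))"
  define G where "G = (if \<forall>x\<in>{a<..<b}. F x > x then (\<lambda>x. - (b - x)\<^sup>2 / 2) else (\<lambda>x. (x - a)\<^sup>2 / 2))"
  have "(LBINT x:{a..b}. g x) = G b - G a"
    unfolding set_lebesgue_integral_def real_scaleR_def mult.commute[of "indicator _ _"]
    by (rule integral_FTC_Icc_real[OF ab(2)]) (auto simp: G_def g_def field_simps intro!: derivative_eq_intros)
  also have "\<dots> = (b - a)\<^sup>2 / 2"
    by (simp add: G_def)
  finally have "(b - a)\<^sup>2 / 2 = (LBINT x:{a..b}. g x)" by simp
  also have "\<dots> \<le> (LBINT x:{a..b}. D x - m)"
  proof (rule set_integral_mono)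
    show "set_integrable lborel {a..b} g"
      by (intro borel_integrable_atLeastAtMost') (auto simp: g_def intro!: continuous_intros)
    show "set_integrable lborel {a..b} (\<lambda>x. D x - m)"
      using ab by (intro set_integrable_D) auto
    fix x assume x: "x \<in> {a..b}"
    show "g x \<le> D x - m"
    proof (cases "\<forall>x\<in>{a<..<b}. F x > x")
      case True
      then have "D x - D b = 1 * (b - x)"
        using ab x by (intro D_diff_eq_on_gap[of a _ _ b]) (auto simp: s_def)
      then show ?thesis using True min[of b] ab by (simp add: g_def)
    next
      case False
      then have "D a - D x = (-1) * (x - a)"
        using ab x gap by (intro D_diff_eq_on_gap[of a _ _ b]) (auto simp: s_def)
      moreover have "g x = x - a" using False by (auto simp: g_def)
      ultimately show ?thesis using min[of a] ab by simp
    qed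
  qed
  finally show ?thesis .
qed

text \<open>Intermediate value theorem: a change of sign of \<open>F x - x\<close> would force a
  fixed point in the gap.\<close>

lemma sign_constant_on_gap:
  assumes "\<forall>x\<in>{a<..<b}. F x \<noteq> x"
  shows "(\<forall>x\<in>{a<..<b}. F x > x) \<or> (\<forall>x\<in>{a<..<b}. F x < x)"
proof (rule ccontr)
  assume "\<not> ?thesis"
  then obtain y z where yz: "y \<in> {a<..<b}" "z \<in> {a<..<b}" "F y - y \<le> 0" "0 \<le> F z - z"
    by (auto simp: not_less)
  let ?I = "(\<lambda>x. F x - x) ` {a<..<b}"
  have "connected ?I"
    by (intro connected_continuous_image continuous_intros continuous_on_subset[OF cont]) auto
  then have "0 \<in> ?I"
    using yz connectedD_interval[of ?I "F y - y" "F z - z" 0] by blast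
  with assms show False by auto
qed

text \<open>Summing \<open>l\<^sup>2 / 2 \<ge> T l - T\<^sup>2 / 2\<close> over the lengths \<open>l\<close> of the gaps replaces the Cauchy--Schwarz
  inequality and lets the induction split off gaps independently of the optimal \<open>T\<close>.\<close>

lemma integral_ge_fixed_points:
  assumes "0 \<le> a" "a \<le> b" "b \<le> 1" and min: "\<And>x. x \<in> {0..1} \<Longrightarrow> m \<le> D x"
  shows "T * (b - a) - (real (card {x \<in> {a<..<b}. F x = x}) + 1) * T\<^sup>2 / 2
    \<le> (LBINT x:{a..b}. D x - m)"
  using assms(1-3)
proof (induction "card {x \<in> {a<..<b}. F x = x}" arbitrary: a b rule: less_induct)
  case less
  let ?Z = "\<lambda>a b. {x \<in> {a<..<b}. F x = x}"
  have fin_Z: "finite (?Z a' b')" if "0 \<le> a'" "b' \<le> 1" for a' b'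
    by (rule finite_subset[OF _ fin]) (use that in auto)
  show ?case
  proof (cases "?Z a b = {}")
    case True
    \<comment> \<open>Expanding the square compares \<open>l^2 / 2\<close> with its tangent line at
      \<open>l = T\<close>.\<close>
    have "0 \<le> (b - a - T)\<^sup>2" by simp
    then have "T * (b - a) - T\<^sup>2 / 2 \<le> (b - a)\<^sup>2 / 2"
      by (simp add: power2_eq_square algebra_simps)
    also have "\<dots> \<le> (LBINT x:{a..b}. D x - m)"
      using True less.prems by (intro gap_integral_ge sign_constant_on_gap min) auto
    finally show ?thesis unfolding True by simp
  next
    case False
    then obtain z where z: "a < z" "z < b" "F z = z" by auto
    have Z: "?Z a b = insert z (?Z a z \<union> ?Z z b)" using z by auto
    \<comment> \<open>The extra 1 counts \<open>z\<close> itself. It makes the number of gaps, one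
      more than the number of interior fixed points, additive under the split.\<close>
    have card: "card (?Z a b) = card (?Z a z) + card (?Z z b) + 1"
      unfolding Z using z less.prems fin_Z
      by (subst card_insert_disjoint) (auto simp: card_Un_disjoint disjoint_iff)
    have "(LBINT x:{a..b}. D x - m) = (LBINT x:{a..z}. D x - m) + (LBINT x:{z..b}. D x - m)"
    proof -
      have "(LBINT x:{a..b}. D x - m) = (LBINT x:{a..z} \<union> {z..b}. D x - m)"
        using z by (simp add: ivl_disj_un_two_touch(4))
      also have "\<dots> = (LBINT x:{a..z}. D x - m) + (LBINT x:{z..b}. D x - m)"
      proof (rule set_integral_Un_AE)
        have "AE x in lborel. x \<noteq> z" by (rule AE_lborel_singleton)
        then show "AE x in lborel. \<not> (x \<in> {a..z} \<and> x \<in> {z..b})"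
          by eventually_elim auto
      qed (use z less.prems in \<open>auto intro: set_integrable_D\<close>)
      finally show ?thesis .
    qed
    moreover have "T * (z - a) - (real (card (?Z a z)) + 1) * T\<^sup>2 / 2 \<le> (LBINT x:{a..z}. D x - m)"
      using z less.prems card by (intro less.hyps) auto
    moreover have "T * (b - z) - (real (card (?Z z b)) + 1) * T\<^sup>2 / 2 \<le> (LBINT x:{z..b}. D x - m)"
      using z less.prems card by (intro less.hyps) auto
    ultimately show ?thesis
      unfolding card by (simp add: algebra_simps add_divide_distrib)
  qed
qed

section \<open>Location and size of the minimum\<close>

text \<open>The endpoints 0 and 1 are fixed points, so any other kind of point is interior. Near it
  \<open>D\<close> has slope -1 or 1 and takes a smaller value on one side.\<close>

lemma minimum_at_fixed_point:
  assumes x0: "x0 \<in> {0..1}" and min: "\<And>x. x \<in> {0..1} \<Longrightarrow> D x0 \<le> D x"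
  shows "F x0 = x0"
proof (rule ccontr)
  assume ne: "F x0 \<noteq> x0"
  then have x01: "0 < x0" "x0 < 1"
    using x0 F_0 F_1 by (auto simp: less_le)
  have "open {x. F x \<noteq> x}"
    by (intro open_Collect_neq continuous_intros cont)
  then have "open ({x. F x \<noteq> x} \<inter> {0<..<1})" by auto
  then obtain d where d: "d > 0" "ball x0 d \<subseteq> {x. F x \<noteq> x} \<inter> {0<..<1}"
    using ne x01 openE[of "{x. F x \<noteq> x} \<inter> {0<..<1}" x0] by auto
  \<comment> \<open>Half the radius keeps the closed interval, endpoints included, inside the
    ball.\<close>
  define a b where "a = x0 - d / 2" and "b = x0 + d / 2"
  have sub: "{a..b} \<subseteq> {x. F x \<noteq> x} \<inter> {0<..<1}"
  proof
    fix x assume "x \<in> {a..b}"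
    then have "x \<in> ball x0 d" using d(1) by (auto simp: a_def b_def dist_real_def)
    then show "x \<in> {x. F x \<noteq> x} \<inter> {0<..<1}" using d(2) by blast
  qed
  have "a < x0" "x0 < b" using d(1) by (auto simp: a_def b_def)
  then have "a \<in> {a..b}" "b \<in> {a..b}" by auto
  then have ab: "0 \<le> a" "b \<le> 1" using sub by auto
  note ab = this \<open>a < x0\<close> \<open>x0 < b\<close>
  have "(\<forall>x\<in>{a<..<b}. F x > x) \<or> (\<forall>x\<in>{a<..<b}. F x < x)"
    using sub greaterThanLessThan_subseteq_atLeastAtMost_iff[of a b a b]
    by (intro sign_constant_on_gap) blast
  then show False
  proof
    assume "\<forall>x\<in>{a<..<b}. F x > x"
    then have "D x0 - D b = 1 * (b - x0)"
      using ab by (intro D_diff_eq_on_gap[of a _ _ b]) (auto simp: s_def)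
    then show False using min[of b] ab by auto
  next
    assume "\<forall>x\<in>{a<..<b}. F x < x"
    then have "D a - D x0 = (-1) * (x0 - a)"
      using ab by (intro D_diff_eq_on_gap[of a _ _ b]) (auto simp: s_def)
    then show False using min[of a] ab by auto
  qed
qed

text \<open>The unit interval has length 1, so \<open>m\<close> is the integral of \<open>D\<close>,
  which is nonpositive, minus that of \<open>D - m\<close>.\<close>

lemma minimum_le:
  assumes min: "\<And>x. x \<in> {0..1} \<Longrightarrow> m \<le> D x"
  shows "m \<le> - (LBINT x:{0..1}. D x - m)"
proof -
  have "(LBINT x:{0..1}. D x - m) = (LBINT x:{0..1}. D x) - (LBINT x:{0..1::real}. m)"
    using set_integrable_D[of 0 1 0]
    by (intro set_integral_diff(2) borel_integrable_atLeastAtMost') (auto intro: continuous_on_D)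
  then show ?thesis
    using integral_D_nonpos by (simp add: set_integral_const)
qed

text \<open>The triangle over the gap between \<open>Inf J\<close> and \<open>Sup J\<close> already
  bounds the full integral of \<open>D - m\<close> from below, because that integrand is
  nonnegative.\<close>

lemma minimum_le_interval:
  assumes min: "\<And>x. x \<in> {0..1} \<Longrightarrow> m \<le> D x"
    and J: "is_interval J" "J \<subseteq> {0..1}" "(\<forall>x\<in>J. F x > x) \<or> (\<forall>x\<in>J. F x < x)"
  shows "m \<le> - ((measure lborel J)\<^sup>2 / 2)"
proof (cases "J = {}")
  case True
  \<comment> \<open>Infimum and supremum of the empty set carry no information; here the claim is
    just \<open>m \<le> 0\<close>.\<close>
  have "0 \<le> (LBINT x:{0..1}. D x - m)"
    unfolding set_lebesgue_integral_def
    by (intro Bochner_Integration.integral_nonneg) (use min in \<open>auto simp: indicator_def\<close>)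
  with True minimum_le[OF min] show ?thesis by simp
next
  case False
  define a b where "a = Inf J" and "b = Sup J"
  have bdd: "bdd_below J" "bdd_above J"
    using J(2) by (meson bdd_below_Icc bdd_above_Icc bdd_below_mono bdd_above_mono)+
  have J_sub: "J \<subseteq> {a..b}"
    unfolding a_def b_def using bdd by (auto intro: cInf_lower cSup_upper)
  have sub_J: "{a<..<b} \<subseteq> J"
  proof
    fix x assume "x \<in> {a<..<b}"
    then obtain y z where "y \<in> J" "y < x" "z \<in> J" "x < z"
      unfolding a_def b_def using cInf_lessD[OF False] less_cSupD[OF False]
      by (metis greaterThanLessThan_iff)
    then show "x \<in> J" using J(1) mem_is_interval_1_I[of J y z x] by auto
  qed
  have ab: "0 \<le> a" "a \<le> b" "b \<le> 1"
    using False J(2) J_sub unfolding a_def b_def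
    by (auto intro!: cInf_greatest cSup_least) 
  \<comment> \<open>\<open>J\<close> differs from an open interval by at most two points and is
    therefore Borel, so its measure can be compared with that of \<open>{a..b}\<close>.\<close>
  have "J = {a<..<b} \<union> (J \<inter> {a, b})"
    using J_sub sub_J by force
  then have "J \<in> sets lborel"
    by (metis finite.emptyI finite_Int finite_insert finite_imp_closed borel_closed sets_lborel
        borel_open open_greaterThanLessThan sets.Un)
  then have "measure lborel J \<le> measure lborel {a..b}"
    using J_sub by (intro measure_mono_fmeasurable) (auto simp: fmeasurable_def emeasure_lborel_Icc_eq)
  then have "(measure lborel J)\<^sup>2 \<le> (b - a)\<^sup>2"
    using ab by (intro power_mono) auto
  also have "(b - a)\<^sup>2 / 2 \<le> (LBINT x:{a..b}. D x - m)"
    using ab J(3) sub_J by (intro gap_integral_ge min) blast+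
  moreover have "(LBINT x:{a..b}. D x - m) \<le> (LBINT x:{0..1}. D x - m)"
    unfolding set_lebesgue_integral_def
    by (rule integral_mono)
      (use ab min set_integrable_D in \<open>auto simp: set_integrable_def indicator_def\<close>)
  ultimately show ?thesis
    using minimum_le[OF min] by simp
qed

text \<open>Besides 0 and 1 there are \<open>S - 2\<close> fixed points, leaving
  \<open>S - 1\<close> gaps of total length 1; equal gaps are the worst case.\<close>

lemma minimum_le_card:
  assumes min: "\<And>x. x \<in> {0..1} \<Longrightarrow> m \<le> D x"
  defines "S \<equiv> card {x \<in> {0..1}. F x = x}"
  shows "m \<le> - (1 / (2 * (real S - 1)))" and "S \<ge> 2"
proof -
  let ?Z = "{x \<in> {0<..<1}. F x = x}"
  have eq: "{x \<in> {0..1}. F x = x} = insert 0 (insert 1 ?Z)"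
    using F_0 F_1 by (auto simp: less_le)
  have "finite ?Z" by (rule finite_subset[OF _ fin]) auto
  then have S: "S = card ?Z + 2"
    unfolding S_def eq by (subst card_insert_disjoint; simp)
  then show "S \<ge> 2" by simp
  \<comment> \<open>The mean gap length, which maximizes \<open>T - (S - 1) * T^2 / 2\<close> with
    value \<open>T / 2\<close>.\<close>
  define T where "T = 1 / (real S - 1)"
  have "T * (1 - 0) - (real (card ?Z) + 1) * T\<^sup>2 / 2 \<le> (LBINT x:{0..1}. D x - m)"
    by (rule integral_ge_fixed_points) (use min in auto)
  also have "T * (1 - 0) - (real (card ?Z) + 1) * T\<^sup>2 / 2 = 1 / (2 * (real S - 1))"
  proof -
    have "T * (1 - 0) - (1 / T) * T\<^sup>2 / 2 = T / 2"
      by (simp add: power2_eq_square)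
    moreover have "real (card ?Z) + 1 = 1 / T" "T / 2 = 1 / (2 * (real S - 1))"
      unfolding T_def S by simp_all
    ultimately show ?thesis by metis
  qed
  finally show "m \<le> - (1 / (2 * (real S - 1)))"
    using minimum_le[OF min] by simp
qed

end

section \<open>Mixtures with a Dirac measure, and measures with a density\<close>

text \<open>The range of \<open>\<epsilon>\<close> keeps both weights nonnegative, so
  \<open>ennreal\<close> sums reduce to real ones; the Dirac measure in \<open>x\<close> contributes
  a unit step at \<open>x\<close>.\<close>

lemma unit_prob_space_mix_return:
  assumes "unit_prob_space \<mu>" and \<epsilon>: "0 \<le> \<epsilon>" "\<epsilon> \<le> 1" and x: "x \<in> {0..1}"
  shows "unit_prob_space (mix_measure \<epsilon> \<mu> (return \<mu> x))"
    and "y \<in> {0..1} \<Longrightarrow> unit_cdf (mix_measure \<epsilon> \<mu> (return \<mu> x)) y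
      = (1 - \<epsilon>) * unit_cdf \<mu> y + \<epsilon> * indicator {x..} y"
proof -
  interpret unit_prob_space \<mu> by fact
  let ?M = "mix_measure \<epsilon> \<mu> (return \<mu> x)"
  have em: "emeasure ?M A = ennreal ((1 - \<epsilon>) * measure \<mu> A + \<epsilon> * indicator A x)"
    if "A \<in> sets \<mu>" for A
    using that \<epsilon>
    by (simp add: emeasure_mix_measure emeasure_eq_measure ennreal_mult ennreal_plus
        flip: ennreal_indicator)
  show "unit_prob_space ?M"
  proof (intro unit_prob_space.intro unit_prob_space_axioms.intro prob_spaceI)
    show "emeasure ?M (space ?M) = 1"
      using em[OF sets.top] x prob_space by (simp add: space_unit)
  qed (simp add: sets_unit)
  show "unit_cdf ?M y = (1 - \<epsilon>) * unit_cdf \<mu> y + \<epsilon> * indicator {x..} y" if y: "y \<in> {0..1}"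
  proof -
    have "{0..y} \<in> sets \<mu>"
      unfolding sets_unit using y by (subst sets_restrict_space_iff) auto
    then have "measure ?M {0..y} = (1 - \<epsilon>) * measure \<mu> {0..y} + \<epsilon> * indicator {0..y} x"
      using \<epsilon> by (intro measure_eq_emeasure_eq_ennreal em) auto
    then show ?thesis
      using x by (simp add: unit_cdf_def indicator_def)
  qed
qed

lemma smooth_on_imp_continuous_on:
  assumes "smooth_on S f"
  shows "continuous_on S f"
  using assms unfolding smooth_on_def by (metis DERIV_continuous_on)

lemma sets_density_measure: "sets (density_measure \<phi>) = sets (restrict_space borel {0..1})"
  by (simp add: density_measure_def cong: sets_restrict_space_cong)

lemma unit_cdf_density_measure:
  assumes cont: "continuous_on {0..1} \<phi>" and nonneg: "\<And>y. y \<in> {0..1} \<Longrightarrow> 0 \<le> \<phi> y"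
    and x: "x \<in> {0..1}"
  shows "unit_cdf (density_measure \<phi>) x = (LBINT y:{0..x}. \<phi> y)"
proof -
  have meas: "\<phi> \<in> borel_measurable (restrict_space lborel {0..1})"
    using borel_measurable_continuous_on_restrict[OF cont]
    by (simp add: measurable_cong_sets[OF sets_restrict_space_cong[OF sets_lborel] refl])
  have int: "integrable lborel (\<lambda>y. indicator {0..x} y *\<^sub>R \<phi> y)"
    using borel_integrable_atLeastAtMost'[of 0 x \<phi>] continuous_on_subset[OF cont, of "{0..x}"] x
    by (simp add: set_integrable_def)
  have "{0..x} \<in> sets (restrict_space lborel {0..1})"
    using x by (subst sets_restrict_space_iff) auto
  then have "emeasure (density_measure \<phi>) {0..x}
      = (\<integral>\<^sup>+y. ennreal (\<phi> y) * indicator {0..x} y * indicator {0..1} y \<partial>lborel)"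
    unfolding density_measure_def using meas
    by (simp add: emeasure_density nn_integral_restrict_space)
  \<comment> \<open>The indicator of \<open>{0..1}\<close>, which comes from the restricted carrier,
    is absorbed by that of \<open>{0..x}\<close>.\<close>
  also have "\<dots> = (\<integral>\<^sup>+y. ennreal (indicator {0..x} y *\<^sub>R \<phi> y) \<partial>lborel)"
    using x by (intro nn_integral_cong) (auto simp: indicator_def)
  also have "\<dots> = ennreal (LBINT y:{0..x}. \<phi> y)"
    unfolding set_lebesgue_integral_def using x nonneg
    by (intro nn_integral_eq_integral int) (auto simp: indicator_def)
  finally show ?thesis
    unfolding unit_cdf_def measure_def set_lebesgue_integral_def using x nonneg
    by (subst enn2real_ennreal[symmetric]) (auto simp: indicator_def intro!: Bochner_Integration.integral_nonneg)
qed

theorem theorem3: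
  fixes \<phi> \<Phi> :: "real \<Rightarrow> real" and \<mu> :: "real measure" and c C :: real
  assumes mu: "\<mu> = density_measure \<phi>"
    and prob: "prob_space \<mu>"
    and smooth: "smooth_on {0..1} \<phi>"
    and c_pos: "0 < c"
    and bounds: "\<forall>x\<in>{0..1}. c < \<phi> x \<and> \<phi> x < C"
    and Phi: "\<forall>x\<in>{0..1}. \<Phi> x = (LBINT y:{0..x}. \<phi> y)"
    and fin: "finite {x\<in>{0..1}. \<Phi> x = x}"
  shows "(\<forall>x\<in>{0..1}. \<exists>L. (energy_quotient \<mu> x \<longlongrightarrow> L) (at_right 0)) \<and>
    (\<exists>x0\<in>{0..1}.
        (\<forall>x\<in>{0..1}. energy_deriv \<mu> x0 \<le> energy_deriv \<mu> x) \<and>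
        \<Phi> x0 = x0 \<and>
        energy_deriv \<mu> x0 < 0 \<and>
        (\<forall>J. is_interval J \<and> J \<subseteq> {0..1} \<and> ((\<forall>x\<in>J. \<Phi> x > x) \<or> (\<forall>x\<in>J. \<Phi> x < x)) \<longrightarrow>
            energy_deriv \<mu> x0 \<le> - ((measure lborel J)\<^sup>2 / 4)) \<and>
        (\<forall>S::nat. card {x\<in>{0..1}. \<Phi> x = x} = S \<longrightarrow>
            energy_deriv \<mu> x0 \<le> - (1 / (4 * real S))))"
proof -
  have cont: "continuous_on {0..1} \<phi>"
    using smooth by (rule smooth_on_imp_continuous_on)
  have pos: "0 < \<phi> y" if "y \<in> {0..1}" for y
    using bounds c_pos that by force
  have unit: "unit_prob_space \<mu>"
    using prob mu by (simp add: unit_prob_space_def unit_prob_space_axioms_def sets_density_measure)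
  then interpret \<mu>: unit_prob_space \<mu> .
  have cdf: "unit_cdf \<mu> x = \<Phi> x" if "x \<in> {0..1}" for x
    using unit_cdf_density_measure[OF cont _ that] pos Phi that mu by (simp add: less_imp_le)
  \<comment> \<open>\<open>\<Phi>\<close> is unconstrained outside the unit interval; clamping the
    argument extends it by constants to a function continuous on the line.\<close>
  define F where "F x = \<Phi> (max 0 (min 1 x))" for x
  have F: "F x = \<Phi> x" if "x \<in> {0..1}" for x
    using that by (simp add: F_def)
  have fixed: "{x \<in> {0..1}. F x = x} = {x \<in> {0..1}. \<Phi> x = x}"
    using F by auto
  \<comment> \<open>Passing to the gauge integral makes continuity of indefinite integrals
    applicable.\<close>
  have "\<Phi> x = integral {0..x} \<phi>" if "x \<in> {0..1}" for x
    using that Phi set_borel_integral_eq_integral(2)[OF borel_integrable_atLeastAtMost'[of 0 x \<phi>]]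
      continuous_on_subset[OF cont, of "{0..x}"] by auto
  moreover have "continuous_on {0..1} (\<lambda>x. integral {0..x} \<phi>)"
    by (intro indefinite_integral_continuous_1 integrable_continuous_real cont)
  ultimately have "continuous_on {0..1} \<Phi>"
    by (simp cong: continuous_on_cong_simp)
  then have cont_F: "continuous_on UNIV F"
    unfolding F_def by (rule continuous_on_compose2) (auto intro!: continuous_intros)
  interpret fixed_point_gaps F
  proof
    have "AE y in lborel. y \<noteq> (0::real)" by (rule AE_lborel_singleton)
    then show "F 0 = 0"
      using F[of 0] Phi
      by (auto simp: set_lebesgue_integral_def indicator_def intro!: integral_eq_zero_AE elim: eventually_mono)
    show "F 1 = 1"
      using F[of 1] cdf[of 1] \<mu>.unit_cdf_1 by simp
    show "F x \<in> {0..1}" if "x \<in> {0..1}" for x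
      using F[OF that] cdf[OF that] \<mu>.prob_le_1 by (simp add: unit_cdf_def flip: cdf[OF that])
  qed (use fin fixed cont_F in auto)
  have lim: "(energy_quotient \<mu> x \<longlongrightarrow> D x) (at_right 0)" if x: "x \<in> {0..1}" for x
  proof (rule Lim_transform_eventually[OF quotient_tendsto_D[of x]])
    \<comment> \<open>Only for weights in the unit interval is the mixture a probability measure,
      which the energy formula requires; near 0 this holds.\<close>
    have "\<forall>\<^sub>F \<epsilon> in at_right (0::real). \<epsilon> \<in> {0<..<1}"
      by (rule eventually_at_right_field[THEN iffD2]) (auto intro: exI[of _ 1])
    then show "\<forall>\<^sub>F \<epsilon> in at_right 0.
        ((LBINT y:{0..1}. \<bar>(1 - \<epsilon>) * F y + \<epsilon> * indicator {x..} y - y\<bar>) - (LBINT y:{0..1}. \<bar>F y - y\<bar>)) / \<epsilon>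
          = energy_quotient \<mu> x \<epsilon>"
    proof eventually_elim
      case (elim \<epsilon>)
      then have \<epsilon>: "0 \<le> \<epsilon>" "\<epsilon> \<le> 1" by auto
      note mix = unit_prob_space_mix_return[OF unit \<epsilon> x]
      have "energy (mix_measure \<epsilon> \<mu> (return \<mu> x))
          = (LBINT y:{0..1}. \<bar>(1 - \<epsilon>) * F y + \<epsilon> * indicator {x..} y - y\<bar>)"
        unfolding unit_prob_space.energy_eq_integral_cdf[OF mix(1)]
        by (intro set_lebesgue_integral_cong) (auto simp: mix(2) F cdf)
      moreover have "energy \<mu> = (LBINT y:{0..1}. \<bar>F y - y\<bar>)"
        unfolding \<mu>.energy_eq_integral_cdf
        by (intro set_lebesgue_integral_cong) (auto simp: F cdf)
      ultimately show ?case
        by (simp add: energy_quotient_def)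
    qed
  qed
  \<comment> \<open>The limit exists, so \<open>Lim\<close> returns it.\<close>
  then have deriv: "energy_deriv \<mu> x = D x" if "x \<in> {0..1}" for x
    unfolding energy_deriv_def using that by (intro tendsto_Lim) auto
  obtain x0 where x0: "x0 \<in> {0..1}" and min: "\<And>x. x \<in> {0..1} \<Longrightarrow> D x0 \<le> D x"
    using continuous_attains_inf[OF compact_Icc _ continuous_on_D] by force
  let ?S = "card {x \<in> {0..1}. \<Phi> x = x}"
  note S = minimum_le_card[OF min, unfolded fixed]
  \<comment> \<open>The bound obtained is sharper than the one claimed. \<open>S \<ge> 2\<close>
    keeps both denominators positive, and the weaker bound still yields strict negativity.\<close>
  have "1 / (4 * real ?S) \<le> 1 / (2 * (real ?S - 1))"
    using S(2) by (intro divide_left_mono mult_pos_pos) auto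
  then have le_S: "D x0 \<le> - (1 / (4 * real ?S))"
    using S(1) by simp
  also have "\<dots> < 0" using S(2) by simp
  finally have neg: "D x0 < 0" .
  have le_J: "D x0 \<le> - ((measure lborel J)\<^sup>2 / 4)"
    if "is_interval J" "J \<subseteq> {0..1}" "(\<forall>x\<in>J. \<Phi> x > x) \<or> (\<forall>x\<in>J. \<Phi> x < x)" for J
  proof -
    have "(\<forall>x\<in>J. F x > x) \<or> (\<forall>x\<in>J. F x < x)"
      using that(2,3) F by (metis subsetD)
    then have "D x0 \<le> - ((measure lborel J)\<^sup>2 / 2)"
      using minimum_le_interval[OF min that(1,2)] by blast
    also have "\<dots> \<le> - ((measure lborel J)\<^sup>2 / 4)" by simp
    finally show ?thesis .
  qed
  have "\<Phi> x0 = x0"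
    using minimum_at_fixed_point[OF x0 min] F[OF x0] by simp
  with x0 min neg le_S le_J lim show ?thesis
    by (intro conjI ballI bexI[of _ x0]) (auto simp: deriv)
qed

end
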